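(* Let $G=(V,E)$ be a connected undirected graph with nodes $v_1,\dots,v_M$, and fix $\varepsilon\in(0,\frac1{\Delta+1}]$, where $\Delta$ is the maximum degree, and $\eta\in(0,1)$. Let $S$ be the set of pairs $(\{p,q\},k)$, with $(v_p,v_q)\in E$ and $k\ge0$, for which the inter-node weight $a_{pq}[k]$ is accessible to an eavesdropper. Let $j$ be a node having at least one neighbor $m$ such that $a_{jm}[0]$ is inaccessible to the eavesdropper, i.e. $(\{j,m\},0)\notin S$. Then the eavesdropper cannot infer $x_j[0]$ with any guaranteed accuracy, in the following sense: for every admissible execution of the state-decomposition protocol with $x_j^{\alpha}[0]\ne x_m^{\alpha}[0]$, and for every $\hat x\in\mathbb{R}$ and every $\delta>0$, there is another admissible execution (its quantities denoted by bars) on the same graph with the same $\varepsilon,\eta$, such that the information accessible to the eavesdropper is identical in the two executions, that is, $\bar x_p^{\alpha}[k]=x_p^{\alpha}[k]$ for all nodes $p$ and all $k\ge0$ and $\bar a_{pq}[k]=a_{pq}[k]$ for all $(\{p,q\},k)\in S$, and $|\bar x_j[0]-\hat x|>\delta$.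
   Context: The graph is fixed and without self-loops; $N_p=\{v_q:(v_p,v_q)\in E\}$. An admissible execution of the state-decomposition protocol consists of: (1) Decomposition Mechanism: real initial states $x_p[0]$ and real initial sub-states $x_p^{\alpha}[0],x_p^{\beta}[0]$ with $x_p^{\alpha}[0]+x_p^{\beta}[0]=2x_p[0]$ for every node $p$. (2) Weight Mechanism: real coupling weights $a_{pq}[k]=a_{qp}[k]$ for edges $(v_p,v_q)\in E$ (and $a_{pq}[k]=0$ for non-edges) and $a_{p,\alpha\beta}[k]$ for every node $p$, $k\ge 0$. At $k=0$ the edge weights and the weights $a_{p,\alpha\beta}[0]$ are arbitrary real numbers; for $k\ge1$, $\eta\le a_{pq}[k]<1$ for every edge and $\eta\le a_{p,\alpha\beta}[k]<1$ for every node $p$. (3) The sub-states generated for $k\ge0$ by $$x_p^{\alpha}[k+1]=x_p^{\alpha}[k]+\varepsilon\sum_{v_q\in N_p}a_{pq}[k](x_q^{\alpha}[k]-x_p^{\alpha}[k])+\varepsilon a_{p,\alpha\beta}[k](x_p^{\beta}[k]-x_p^{\alpha}[k]),$$ $$x_p^{\beta}[k+1]=x_p^{\beta}[k]+\varepsilon a_{p,\alpha\beta}[k](x_p^{\alpha}[k]-x_p^{\beta}[k]).$$ An eavesdropper is an external attacker who knows the network topology and can wiretap communication links and access exchanged messages; the exchanged states are the $x_p^{\alpha}[k]$. The quantities $x_p[0]$, $x_p^{\beta}[k]$ and $a_{p,\alpha\beta}[k]$ are internal to node $p$ and not accessible to the eavesdropper. Privacy: the privacy of $x_j[0]$ is preserved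 if an adversary cannot estimate the value of $x_j[0]$ with any guaranteed accuracy, i.e. from its accessible information it cannot find any finite range guaranteed to contain $x_j[0]$. *)

theory Defs
  imports Complex_Main "Graph_Theory.Graph_Theory"
begin

text \<open>
  An undirected simple graph is a \<open>pair_graph\<close>: finite, loop-free, with a symmetric set
  of arcs \<open>parcs G\<close>. Each undirected edge appears as the two arcs \<open>(p, q)\<close> and \<open>(q, p)\<close>, so
  the degree of a node is its out-degree.
\<close>

definition max_degree :: "'v pair_pre_digraph \<Rightarrow> nat" where
  "max_degree G = Max ((\<lambda>p. out_degree (with_proj G) p) ` pverts G)"

definition neighbours :: "'v pair_pre_digraph \<Rightarrow> 'v \<Rightarrow> 'v set" where
  "neighbours G p = {q. (p, q) \<in> parcs G}"

text \<open>
  \<open>init X p\<close> is $x_p[0]$, \<open>alpha X k p\<close> is $x_p^\alpha[k]$, \<open>beta X k p\<close> is $x_p^\beta[k]$,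
  \<open>weight X k p q\<close> is $a_{pq}[k]$, and \<open>coupling X k p\<close> is $a_{p,\alpha\beta}[k]$.
  Values at elements of the type that are not nodes of the graph are irrelevant.
\<close>

record 'v execution =
  init :: "'v \<Rightarrow> real"
  alpha :: "nat \<Rightarrow> 'v \<Rightarrow> real"
  beta :: "nat \<Rightarrow> 'v \<Rightarrow> real"
  weight :: "nat \<Rightarrow> 'v \<Rightarrow> 'v \<Rightarrow> real"
  coupling :: "nat \<Rightarrow> 'v \<Rightarrow> real"

definition decomposition_mechanism :: "'v pair_pre_digraph \<Rightarrow> 'v execution \<Rightarrow> bool" where
  "decomposition_mechanism G X \<longleftrightarrow>
     (\<forall>p\<in>pverts G. alpha X 0 p + beta X 0 p = 2 * init X p)"

text \<open>At time 0 the edge weights and the couplings are arbitrary reals: \<open>\<eta>\<close> only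
  constrains them from time 1 on.\<close>

definition weight_mechanism :: "'v pair_pre_digraph \<Rightarrow> real \<Rightarrow> 'v execution \<Rightarrow> bool" where
  "weight_mechanism G \<eta> X \<longleftrightarrow>
     (\<forall>k p q. (p, q) \<in> parcs G \<longrightarrow> weight X k p q = weight X k q p) \<and>
     (\<forall>k. \<forall>p\<in>pverts G. \<forall>q\<in>pverts G. (p, q) \<notin> parcs G \<longrightarrow> weight X k p q = 0) \<and>
     (\<forall>k\<ge>1. \<forall>p q. (p, q) \<in> parcs G \<longrightarrow> \<eta> \<le> weight X k p q \<and> weight X k p q < 1) \<and>
     (\<forall>k\<ge>1. \<forall>p\<in>pverts G. \<eta> \<le> coupling X k p \<and> coupling X k p < 1)"

definition state_update :: "'v pair_pre_digraph \<Rightarrow> real \<Rightarrow> 'v execution \<Rightarrow> bool" where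
  "state_update G \<epsilon> X \<longleftrightarrow>
     (\<forall>k. \<forall>p\<in>pverts G.
        alpha X (Suc k) p = alpha X k p
          + \<epsilon> * (\<Sum>q\<in>neighbours G p. weight X k p q * (alpha X k q - alpha X k p))
          + \<epsilon> * coupling X k p * (beta X k p - alpha X k p) \<and>
        beta X (Suc k) p = beta X k p + \<epsilon> * coupling X k p * (alpha X k p - beta X k p))"

definition admissible_execution ::
    "'v pair_pre_digraph \<Rightarrow> real \<Rightarrow> real \<Rightarrow> 'v execution \<Rightarrow> bool" where
  "admissible_execution G \<epsilon> \<eta> X \<longleftrightarrow>
     decomposition_mechanism G X \<and> weight_mechanism G \<eta> X \<and> state_update G \<epsilon> X"

text \<open>
  \<open>S\<close> consists of pairs of an undirected edge \<open>{p, q}\<close> and a time at which the weight of that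
  edge is accessible. Exchanged states are the \<open>alpha\<close> sub-states only; \<open>init\<close>, \<open>beta\<close> and
  \<open>coupling\<close> stay internal to the nodes.
\<close>

definition same_eavesdropper_information ::
    "'v pair_pre_digraph \<Rightarrow> ('v set \<times> nat) set \<Rightarrow> 'v execution \<Rightarrow> 'v execution \<Rightarrow> bool" where
  "same_eavesdropper_information G S X Y \<longleftrightarrow>
     (\<forall>k. \<forall>p\<in>pverts G. alpha Y k p = alpha X k p) \<and>
     (\<forall>k p q. (p, q) \<in> parcs G \<longrightarrow> ({p, q}, k) \<in> S \<longrightarrow> weight Y k p q = weight X k p q)"

end

theory Submission
  imports Defs
begin

text \<open>
  Only the quantities at time 0 are altered. Since adding the two updates eliminates the coupling,
  $x_p^\alpha[1] + x_p^\beta[1]$ depends on the decomposition and the edge weights alone. Moving an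
  amount $t$ of hidden $\beta$-mass from $m$ to $j$ is therefore compensated by changing the
  inaccessible weight $a_{jm}[0]$ by $t / (\varepsilon (x_j^\alpha[0] - x_m^\alpha[0]))$. The
  couplings of $j$ and $m$ at time 0 are then solved for so that $x_j^\beta[1]$ and $x_m^\beta[1]$
  are unchanged, which is possible as soon as $\bar x^\beta[0] \ne x^\alpha[0]$ at both nodes;
  all large $t$ qualify, and $x_j[0]$ moves by $t/2$.
\<close>

text \<open>The coupling terms cancel in the sum of the two updates. In the equivalent system
  \<open>c\<close> occurs only in the \<open>b'\<close> equation, so the edge weights can be fitted
  to the first equation and the coupling to the second, independently.\<close>

lemma coupled_update_iff:
  fixes a b a' b' s c :: real
  shows "(a' = a + s + c * (b - a) \<and> b' = b + c * (a - b)) \<longleftrightarrow>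
         (a' + b' = a + b + s \<and> b' = b + c * (a - b))"
  by (auto simp: algebra_simps)

text \<open>Only the summand across the edge between \<open>j\<close> and \<open>m\<close> is
  perturbed, and the difference \<open>x q - x p\<close> changes sign between its two ends. The
  membership assumptions ensure that this summand occurs at both ends.\<close>

lemma sum_perturbed_edge_weight:
  fixes w :: "'v \<Rightarrow> 'v \<Rightarrow> real" and x :: "'v \<Rightarrow> real"
  assumes "finite N" and "j \<noteq> m" and "p = j \<Longrightarrow> m \<in> N" and "p = m \<Longrightarrow> j \<in> N"
  shows "(\<Sum>q\<in>N. (w p q + (if {p, q} = {j, m} then d else 0)) * (x q - x p)) =
         (\<Sum>q\<in>N. w p q * (x q - x p)) +
         d * (x m - x j) * (if p = j then 1 else if p = m then - 1 else 0)"
proof -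
  have "(\<Sum>q\<in>N. (if {p, q} = {j, m} then d else 0) * (x q - x p)) =
        d * (x m - x j) * (if p = j then 1 else if p = m then - 1 else 0)"
  proof -
    consider "p = j" | "p = m" | "p \<noteq> j" "p \<noteq> m" by blast
    then show ?thesis
    proof cases
      case 1
      have "(\<Sum>q\<in>N. (if {p, q} = {j, m} then d else 0) * (x q - x p)) =
            (\<Sum>q\<in>N. if q = m then d * (x m - x j) else 0)"
        using 1 assms(2) by (intro sum.cong) (auto simp: doubleton_eq_iff)
      with 1 assms show ?thesis by simp
    next
      case 2
      have "(\<Sum>q\<in>N. (if {p, q} = {j, m} then d else 0) * (x q - x p)) =
            (\<Sum>q\<in>N. if q = j then d * (x j - x m) else 0)"
        using 2 assms(2) by (intro sum.cong) (auto simp: doubleton_eq_iff)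
      with 2 assms show ?thesis by (simp add: algebra_simps)
    next
      case 3
      then show ?thesis by (auto simp: doubleton_eq_iff intro!: sum.neutral)
    qed
  qed
  then show ?thesis by (simp add: distrib_right sum.distrib)
qed

text \<open>The initial state is the mean of the two sub-states, hence the shift
  \<open>h p / 2\<close>. Testing the unordered pair keeps the weights symmetric. The new coupling
  solves the \<beta> update from \<open>b p\<close> to the old \<open>beta X 1 p\<close>.\<close>

definition shifted_execution ::
    "real \<Rightarrow> 'v \<Rightarrow> 'v \<Rightarrow> real \<Rightarrow> 'v execution \<Rightarrow> 'v execution" where
  "shifted_execution \<epsilon> j m t X =
     (let h = (\<lambda>p. if p = j then t else if p = m then - t else 0);
          b = (\<lambda>p. beta X 0 p + h p);
          d = t / (\<epsilon> * (alpha X 0 j - alpha X 0 m))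
      in \<lparr>init = (\<lambda>p. init X p + h p / 2),
          alpha = alpha X,
          beta = (beta X)(0 := b),
          weight = (\<lambda>k p q. weight X k p q + (if k = 0 \<and> {p, q} = {j, m} then d else 0)),
          coupling = (\<lambda>k p. if k = 0 \<and> (p = j \<or> p = m)
            then (beta X 1 p - b p) / (\<epsilon> * (alpha X 0 p - b p)) else coupling X k p)\<rparr>)"

lemma admissible_shifted_execution:
  assumes G: "pair_graph G" and \<epsilon>: "\<epsilon> > 0" and m: "m \<in> neighbours G j"
    and X: "admissible_execution G \<epsilon> \<eta> X"
    and ne: "alpha X 0 j \<noteq> alpha X 0 m"
    and tj: "beta X 0 j + t \<noteq> alpha X 0 j" and tm: "beta X 0 m - t \<noteq> alpha X 0 m"
  shows "admissible_execution G \<epsilon> \<eta> (shifted_execution \<epsilon> j m t X)"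
proof -
  interpret pair_graph G by (rule G)
  define Y where "Y = shifted_execution \<epsilon> j m t X"
  define h where "h = (\<lambda>p. if p = j then t else if p = m then - t else 0)"
  define d where "d = t / (\<epsilon> * (alpha X 0 j - alpha X 0 m))"
  note Y = Y_def shifted_execution_def Let_def
  have jm: "j \<noteq> m" using ne by auto
  have arc: "(j, m) \<in> parcs G" "(m, j) \<in> parcs G"
    using m arcs_symmetric by (auto simp: neighbours_def)
  have fin: "finite (neighbours G p)" for p
    by (rule finite_subset[of _ "snd ` parcs G"]) (force simp: neighbours_def)+
  have dec: "decomposition_mechanism G Y"
    using X by (auto simp: admissible_execution_def decomposition_mechanism_def Y field_simps)
  \<comment> \<open>Changes occur only at time 0, where the bounds do not apply, and only on an
    actual edge, so non-edges keep weight 0.\<close>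
  have wt: "weight_mechanism G \<eta> Y"
    using X arc by (auto simp: admissible_execution_def weight_mechanism_def Y doubleton_eq_iff)
  have upd: "alpha X (Suc k) p = alpha X k p
          + \<epsilon> * (\<Sum>q\<in>neighbours G p. weight X k p q * (alpha X k q - alpha X k p))
          + \<epsilon> * coupling X k p * (beta X k p - alpha X k p) \<and>
        beta X (Suc k) p = beta X k p + \<epsilon> * coupling X k p * (alpha X k p - beta X k p)"
    if "p \<in> pverts G" for k p
    using X that unfolding admissible_execution_def state_update_def by blast
  have "alpha Y (Suc k) p = alpha Y k p
          + \<epsilon> * (\<Sum>q\<in>neighbours G p. weight Y k p q * (alpha Y k q - alpha Y k p))
          + \<epsilon> * coupling Y k p * (beta Y k p - alpha Y k p) \<and>
        beta Y (Suc k) p = beta Y k p + \<epsilon> * coupling Y k p * (alpha Y k p - beta Y k p)"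
    if p: "p \<in> pverts G" for k p
  proof (cases k)
    case (Suc k')
    then show ?thesis using upd[OF p, of k] by (simp add: Y)
  next
    case 0
    have b: "beta Y 0 p = beta X 0 p + h p" "beta Y (Suc 0) = beta X (Suc 0)" "alpha Y = alpha X"
      by (simp_all add: Y h_def)
    have "(\<Sum>q\<in>neighbours G p. weight Y 0 p q * (alpha X 0 q - alpha X 0 p)) =
        (\<Sum>q\<in>neighbours G p. (weight X 0 p q + (if {p, q} = {j, m} then d else 0))
            * (alpha X 0 q - alpha X 0 p))"
      unfolding d_def by (simp add: Y)
    also have "\<dots> = (\<Sum>q\<in>neighbours G p. weight X 0 p q * (alpha X 0 q - alpha X 0 p)) +
         d * (alpha X 0 m - alpha X 0 j) * (if p = j then 1 else if p = m then - 1 else 0)"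
      using arc by (intro sum_perturbed_edge_weight fin jm) (auto simp: neighbours_def)
    finally have "\<epsilon> * (\<Sum>q\<in>neighbours G p. weight Y 0 p q * (alpha X 0 q - alpha X 0 p)) =
        \<epsilon> * (\<Sum>q\<in>neighbours G p. weight X 0 p q * (alpha X 0 q - alpha X 0 p)) +
        \<epsilon> * d * (alpha X 0 m - alpha X 0 j) * (if p = j then 1 else if p = m then - 1 else 0)"
      by (simp only: distrib_left mult.assoc)
    \<comment> \<open>The value of \<open>d\<close> is chosen for this identity: the neighbour term
      then drops by exactly \<open>h p\<close> at every node.\<close>
    also have "\<epsilon> * d * (alpha X 0 m - alpha X 0 j) = - t"
      using \<epsilon> ne by (simp add: d_def divide_simps) (simp add: algebra_simps)
    finally have s: "\<epsilon> * (\<Sum>q\<in>neighbours G p. weight Y 0 p q * (alpha X 0 q - alpha X 0 p)) =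
        \<epsilon> * (\<Sum>q\<in>neighbours G p. weight X 0 p q * (alpha X 0 q - alpha X 0 p)) - h p"
      by (auto simp: h_def)
    have c: "beta X (Suc 0) p =
        beta Y 0 p + \<epsilon> * coupling Y 0 p * (alpha X 0 p - beta Y 0 p)"
    proof (cases "p = j \<or> p = m")
      case True
      \<comment> \<open>The two conditions on \<open>t\<close> enter here: they make the division in
        the new coupling genuine.\<close>
      then have "alpha X 0 p - beta Y 0 p \<noteq> 0"
        using tj tm by (auto simp: b h_def)
      moreover have "coupling Y 0 p =
          (beta X (Suc 0) p - beta Y 0 p) / (\<epsilon> * (alpha X 0 p - beta Y 0 p))"
        using True by (simp add: Y)
      ultimately show ?thesis using \<epsilon> by simp
    next
      case False
      then show ?thesis using upd[OF p, of 0] by (simp add: Y)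
    qed
    \<comment> \<open>In the same balance for \<open>Y\<close>, the extra \<open>h p\<close> in
      \<open>beta Y 0 p\<close> cancels the loss \<open>- h p\<close> from \<open>s\<close>.\<close>
    have "alpha X (Suc 0) p + beta X (Suc 0) p = alpha X 0 p + beta X 0 p
          + \<epsilon> * (\<Sum>q\<in>neighbours G p. weight X 0 p q * (alpha X 0 q - alpha X 0 p))"
      using upd[OF p, of 0] unfolding coupled_update_iff by blast
    with s c show ?thesis
      unfolding 0 b(2,3) coupled_update_iff using b(1) by simp
  qed
  then have "state_update G \<epsilon> Y" by (simp add: state_update_def)
  with dec wt show ?thesis by (simp add: admissible_execution_def Y_def)
qed

theorem theorem3:
  fixes G :: "'v pair_pre_digraph"
    and \<epsilon> \<eta> :: real
    and S :: "('v set \<times> nat) set"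
    and j m :: 'v
  assumes "pair_graph G"
    and "Digraph_Component.connected (with_proj G)"
    and "0 < \<epsilon>" and "\<epsilon> \<le> 1 / (real (max_degree G) + 1)"
    and "0 < \<eta>" and "\<eta> < 1"
    and "S \<subseteq> {({p, q}, k) | p q k. (p, q) \<in> parcs G}"
    and "j \<in> pverts G"
    and "m \<in> neighbours G j"
    and "({j, m}, 0) \<notin> S"
  shows "\<forall>X. admissible_execution G \<epsilon> \<eta> X \<and> alpha X 0 j \<noteq> alpha X 0 m \<longrightarrow>
           (\<forall>(x_hat :: real) (\<delta> :: real). \<delta> > 0 \<longrightarrow>
              (\<exists>Y. admissible_execution G \<epsilon> \<eta> Y \<and>
                   same_eavesdropper_information G S X Y \<and>
                   \<bar>init Y j - x_hat\<bar> > \<delta>))"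
proof (intro allI impI)
  fix X :: "'v execution" and x_hat \<delta> :: real
  assume X: "admissible_execution G \<epsilon> \<eta> X \<and> alpha X 0 j \<noteq> alpha X 0 m" and \<delta>: "\<delta> > 0"
  \<comment> \<open>The first two bounds push the new \<beta> sub-states strictly past \<alpha> at
    \<open>j\<close> and \<open>m\<close>; the third puts \<open>init X j + t / 2\<close> above
    \<open>x_hat + \<delta>\<close>.\<close>
  obtain t where
    "max (max (alpha X 0 j - beta X 0 j) (beta X 0 m - alpha X 0 m)) (2 * (x_hat + \<delta> - init X j)) < t"
    using gt_ex by blast
  then have t: "alpha X 0 j - beta X 0 j < t" "beta X 0 m - alpha X 0 m < t"
      "2 * (x_hat + \<delta> - init X j) < t"
    by simp_all
  define Y where "Y = shifted_execution \<epsilon> j m t X"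
  have "beta X 0 j + t \<noteq> alpha X 0 j" "beta X 0 m - t \<noteq> alpha X 0 m"
    using t by auto
  then have "admissible_execution G \<epsilon> \<eta> Y"
    unfolding Y_def using X assms by (intro admissible_shifted_execution) auto
  \<comment> \<open>The \<alpha> states are copied, and the only altered weight belongs to the pair
    excluded from \<open>S\<close>.\<close>
  moreover have "same_eavesdropper_information G S X Y"
    using \<open>({j, m}, 0) \<notin> S\<close>
    by (auto simp: same_eavesdropper_information_def Y_def shifted_execution_def Let_def)
  moreover have "init Y j = init X j + t / 2"
    by (simp add: Y_def shifted_execution_def Let_def)
  with t have "init Y j - x_hat > \<delta>"
    by (simp add: field_simps)
  then have "\<bar>init Y j - x_hat\<bar> > \<delta>"
    by simp
  ultimately show "\<exists>Y. admissible_execution G \<epsilon> \<eta> Y \<and>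
      same_eavesdropper_information G S X Y \<and> \<bar>init Y j - x_hat\<bar> > \<delta>"
    by blast
qed

end
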